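(* A graph class $\mathcal C$ has bounded twin-width if and only if there is a class $\mathcal D$ of ordered graphs of bounded merge-width such that $\mathcal C$ is obtained from $\mathcal D$ by forgetting the order, i.e. $\mathcal C=\{(V,E):(V,E,<)\in\mathcal D\}$.
   Context: Graphs are finite, simple and undirected. An ordered graph is a finite structure $G=(V,E,<)$ where $(V,E)$ is a graph (with $E$ viewed as a symmetric irreflexive binary relation) and $<$ is a strict total order on $V$. Twin-width of graphs. Two vertex sets $A,B\subseteq V(G)$ are homogeneous if all pairs $\{a,b\}$ with $a\in A,b\in B,a\ne b$ are edges of $G$, or none of them is. A contraction sequence of $G$ is a sequence of partitions of $V(G)$ starting with the partition into singletons, ending with the partition with one part, where each next partition is obtained by merging two parts into one. The red graph of a partition $\mathcal P$ has vertex set $\mathcal P$ and edges connecting the pairs of distinct parts that are not homogeneous. The twin-width of $G$ is the least $d$ such that $G$ admits a contraction sequence in which the red graph of every partition has maximum degree at most $d$. A class has bounded twin-width if the twin-width of its members is bounded by a constant. Merge-width of ordered graphs. A merge sequence of an ordered graph $G=(V,E,<)$ is a sequence $(\mathcal P_1,R_1),\dots,(\mathcal P_m,R_m)$ such that: $\mathcal P_1,\dots,\mathcal P_m$ are partitions of $V$, with $\mathcal P_1$ the partition into singletons, $\mathcal P_m$ having one part, and each $\mathcal P_t$ coarser than or equal to $\mathcal P_{t-1}$; $R_1\subseteq\dots\subseteq R_m\subseteq\binom V2$; and for all $t$, all $A,B\in\mathcal P_t$ (possibly $A=B$) and each $S\in\{E,<\}$, either all or none of the pairs $(a,b)\in A\times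 B$ with $a\neq b$ and $\{a,b\}\notin R_t$ belong to $S$. Its radius-$r$ width is the maximum, over $t=2,\dots,m$ and $v\in V$, of the number of parts of $\mathcal P_{t-1}$ containing a vertex reachable from $v$ by a path of length at most $r$ in the graph $(V,R_t)$. The radius-$r$ merge-width of $G$ is the least radius-$r$ width of a merge sequence of $G$. A class of ordered graphs has bounded merge-width if for every $r\in\mathbb N$ the radius-$r$ merge-width of its members is bounded by a constant. *)

theory Defs
  imports
    "Graph_Theory.Pair_Digraph"
    "HOL-Library.Disjoint_Sets"
    "HOL-Library.Ramsey"
begin

text \<open>
  A finite simple undirected graph is a \<^const>\<open>pair_graph\<close>: a finite vertex set together with a
  symmetric irreflexive relation on it.  An ordered graph \<open>(V, E, <)\<close> is rendered as the pair of
  the graph \<open>(V, E)\<close> and the relation \<open><\<close>.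

  Empty vertex sets are allowed.  The only partition of the empty set has no part at all, so the
  requirement that a sequence of partitions ends with the partition with one part is stated as
  having at most one part; for nonempty vertex sets this is the same, and the empty graph gets
  width 0.
\<close>

type_synonym 'a ordered_graph = "'a pair_pre_digraph \<times> 'a rel"

definition ordered_graph :: "'a ordered_graph \<Rightarrow> bool" where
  "ordered_graph H \<longleftrightarrow>
     pair_graph (fst H) \<and>
     snd H \<subseteq> pverts (fst H) \<times> pverts (fst H) \<and>
     strict_linear_order_on (pverts (fst H)) (snd H)"

definition singletons :: "'a set \<Rightarrow> 'a set set" where
  "singletons V = (\<lambda>v. {v}) ` V"


definition homogeneous :: "'a pair_pre_digraph \<Rightarrow> 'a set \<Rightarrow> 'a set \<Rightarrow> bool" where
  "homogeneous G A B \<longleftrightarrow>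
     (\<forall>a\<in>A. \<forall>b\<in>B. a \<noteq> b \<longrightarrow> (a, b) \<in> parcs G) \<or>
     (\<forall>a\<in>A. \<forall>b\<in>B. a \<noteq> b \<longrightarrow> (a, b) \<notin> parcs G)"

definition contraction_sequence ::
    "'a pair_pre_digraph \<Rightarrow> nat \<Rightarrow> (nat \<Rightarrow> 'a set set) \<Rightarrow> bool" where
  "contraction_sequence G n P \<longleftrightarrow>
     1 \<le> n \<and>
     (\<forall>t\<in>{1..n}. partition_on (pverts G) (P t)) \<and>
     P 1 = singletons (pverts G) \<and>
     card (P n) \<le> 1 \<and>
     (\<forall>t\<in>{1..<n}. \<exists>A\<in>P t. \<exists>B\<in>P t. A \<noteq> B \<and> P (Suc t) = insert (A \<union> B) (P t - {A, B}))"

definition red_graph :: "'a pair_pre_digraph \<Rightarrow> 'a set set \<Rightarrow> 'a set pair_pre_digraph" where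
  "red_graph G Q =
     \<lparr> pverts = Q,
       parcs = {(A, B). A \<in> Q \<and> B \<in> Q \<and> A \<noteq> B \<and> \<not> homogeneous G A B} \<rparr>"

definition max_degree_at_most :: "'b pair_pre_digraph \<Rightarrow> nat \<Rightarrow> bool" where
  "max_degree_at_most G d \<longleftrightarrow> (\<forall>v\<in>pverts G. card {w. (v, w) \<in> parcs G} \<le> d)"

definition twin_width :: "'a pair_pre_digraph \<Rightarrow> nat" where
  "twin_width G =
     (LEAST d. \<exists>n P. contraction_sequence G n P \<and>
        (\<forall>t\<in>{1..n}. max_degree_at_most (red_graph G (P t)) d))"

definition bounded_twin_width :: "'a pair_pre_digraph set \<Rightarrow> bool" where
  "bounded_twin_width C \<longleftrightarrow> (\<exists>d. \<forall>G\<in>C. twin_width G \<le> d)"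


definition merge_sequence ::
    "'a ordered_graph \<Rightarrow> nat \<Rightarrow> (nat \<Rightarrow> 'a set set) \<Rightarrow> (nat \<Rightarrow> 'a set set) \<Rightarrow> bool" where
  "merge_sequence H m P R \<longleftrightarrow>
     (let V = pverts (fst H) in
      1 \<le> m \<and>
      (\<forall>t\<in>{1..m}. partition_on V (P t)) \<and>
      P 1 = singletons V \<and>
      card (P m) \<le> 1 \<and>
      (\<forall>t\<in>{2..m}. refines V (P (t - 1)) (P t)) \<and>
      (\<forall>t\<in>{1..m}. R t \<subseteq> nsets V 2) \<and>
      (\<forall>t\<in>{2..m}. R (t - 1) \<subseteq> R t) \<and>
      (\<forall>t\<in>{1..m}. \<forall>A\<in>P t. \<forall>B\<in>P t. \<forall>S\<in>{parcs (fst H), snd H}.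
         (\<forall>a\<in>A. \<forall>b\<in>B. a \<noteq> b \<and> {a, b} \<notin> R t \<longrightarrow> (a, b) \<in> S) \<or>
         (\<forall>a\<in>A. \<forall>b\<in>B. a \<noteq> b \<and> {a, b} \<notin> R t \<longrightarrow> (a, b) \<notin> S)))"

definition reachable_within :: "'a set set \<Rightarrow> nat \<Rightarrow> 'a \<Rightarrow> 'a \<Rightarrow> bool" where
  "reachable_within F r u v \<longleftrightarrow>
     (\<exists>p. p \<noteq> [] \<and> hd p = u \<and> last p = v \<and> distinct p \<and>
          successively (\<lambda>x y. {x, y} \<in> F) p \<and> length p - 1 \<le> r)"

text \<open>The inserted 0 is the value of the maximum for \<open>m = 1\<close> or an empty vertex set.\<close>

definition radius_width ::
    "nat \<Rightarrow> 'a ordered_graph \<Rightarrow> nat \<Rightarrow> (nat \<Rightarrow> 'a set set) \<Rightarrow> (nat \<Rightarrow> 'a set set) \<Rightarrow> nat" where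
  "radius_width r H m P R =
     Max (insert 0 {card {A \<in> P (t - 1). \<exists>u\<in>A. reachable_within (R t) r v u} |t v.
                      t \<in> {2..m} \<and> v \<in> pverts (fst H)})"

definition merge_width :: "nat \<Rightarrow> 'a ordered_graph \<Rightarrow> nat" where
  "merge_width r H = (LEAST w. \<exists>m P R. merge_sequence H m P R \<and> radius_width r H m P R = w)"

definition bounded_merge_width :: "'a ordered_graph set \<Rightarrow> bool" where
  "bounded_merge_width D \<longleftrightarrow> (\<forall>r. \<exists>k. \<forall>H\<in>D. merge_width r H \<le> k)"

end

theory Submission
  imports Defs
begin

text \<open>
  From merge-width to twin-width radius 2 suffices. A strict linear order separates \<open>(a, b)\<close> from
  \<open>(b, a)\<close>, so every pair of distinct vertices in a common part of \<open>P t\<close> has to be in \<open>R t\<close>: parts are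
  cliques of resolved pairs (\<open>part_resolved_clique\<close>). Hence whatever some vertex of a part reaches in
  one step, every vertex of the part reaches in at most two steps. A partition \<open>Q\<close> between \<open>P (t - 1)\<close>
  and \<open>P t\<close> has red edges only along pairs in \<open>R t\<close>, so its red degrees are at most the radius-2
  width (\<open>red_degree_le_radius_2_width\<close>). Going from each \<open>P (t - 1)\<close> to \<open>P t\<close> by single merges
  (\<open>merges_between\<close>) gives a contraction sequence.

  Conversely, let a contraction sequence with red degrees at most \<open>d\<close> be given. Order the vertices so
  that of any two distinct parts that ever occur together, one lies entirely before the other
  (\<open>order_homogeneous_on_partition_chain\<close>), and at each stage resolve the pairs that lie inside a part
  or between two parts joined by a red edge. Homogeneous pairs of distinct parts are then homogeneous
  for the order too, so this is a merge sequence. A ball of radius \<open>r\<close> in the resolved pairs meets only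
  parts at red distance at most \<open>r\<close>, which are at most \<open>(d + 1) ^ r\<close> many (\<open>card_parts_reachable\<close>);
  passing to the previous partition splits only one part.

  Both widths are defined by \<open>LEAST\<close>, so they yield a sequence only once some sequence is known to
  exist (\<open>twin_width_attained\<close>, \<open>merge_width_attained\<close>).
\<close>

section \<open>Coarsening a partition by single merges\<close>

definition merges :: "'a set set \<Rightarrow> 'a set set \<Rightarrow> bool" where
  "merges Q Q' \<longleftrightarrow> (\<exists>A\<in>Q. \<exists>B\<in>Q. A \<noteq> B \<and> Q' = insert (A \<union> B) (Q - {A, B}))"

lemma partition_on_part_unique:
  assumes "partition_on V Q" "X \<in> Q" "Y \<in> Q" "x \<in> X" "x \<in> Y"
  shows "X = Y"
  using assms unfolding partition_on_def disjoint_def by blast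

lemma partition_on_part_nonempty:
  assumes "partition_on V Q" "X \<in> Q"
  obtains x where "x \<in> X"
  using assms partition_onD3 by fastforce

lemma partition_on_part_subset:
  assumes "partition_on V Q" "X \<in> Q"
  shows "X \<subseteq> V"
  using assms partition_onD1 by blast

lemma partition_on_cover:
  assumes "partition_on V Q" "x \<in> V"
  obtains X where "X \<in> Q" "x \<in> X"
  using assms partition_onD1 by blast

lemma partition_on_merge:
  assumes "partition_on V Q" "A \<in> Q" "B \<in> Q"
  shows "partition_on V (insert (A \<union> B) (Q - {A, B}))"
proof (rule partition_onI)
  show "\<Union> (insert (A \<union> B) (Q - {A, B})) = V"
    using assms partition_onD1 by fastforce
  show "disjnt p q" if "p \<in> insert (A \<union> B) (Q - {A, B})" "q \<in> insert (A \<union> B) (Q - {A, B})" "p \<noteq> q"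
    for p q
    using that assms partition_on_part_unique[OF assms(1)] unfolding disjnt_iff
    by (metis Diff_iff Un_iff insert_iff)
  show "{} \<notin> insert (A \<union> B) (Q - {A, B})"
    using partition_onD3[OF assms(1)] assms(2) by auto
qed

lemma refines_merge:
  assumes "partition_on V Q" "merges Q Q'"
  shows "refines V Q Q'"
proof -
  obtain A B where AB: "A \<in> Q" "B \<in> Q" and Q': "Q' = insert (A \<union> B) (Q - {A, B})"
    using assms(2) unfolding merges_def by blast
  have "\<exists>Y\<in>Q'. X \<subseteq> Y" if "X \<in> Q" for X
    using that unfolding Q' by (cases "X \<in> {A, B}") auto
  then show ?thesis
    unfolding refines_def using assms(1) partition_on_merge[OF assms(1) AB] Q' by simp
qed

lemma refines_part_subset:
  assumes "refines V Q Q'" "X \<in> Q" "Y \<in> Q'" "x \<in> X" "x \<in> Y"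
  shows "X \<subseteq> Y"
proof -
  obtain Z where "Z \<in> Q'" "X \<subseteq> Z" using assms(1,2) by (auto simp: refines_def)
  then show ?thesis
    using partition_on_part_unique[of V Q' Z Y x] assms by (auto simp: refines_def)
qed

text \<open>As long as the two partitions differ, some part of the coarser one contains two parts of the
  finer one, and these can be merged without leaving the interval between the partitions.\<close>

lemma merges_between:
  assumes "finite V" "refines V Q Q'"
  shows "(\<lambda>X Y. merges X Y \<and> refines V Q Y \<and> refines V Y Q')\<^sup>*\<^sup>* Q Q'"
proof -
  define step where "step = (\<lambda>X Y. merges X Y \<and> refines V Q Y \<and> refines V Y Q')"
  have "step\<^sup>*\<^sup>* S Q'" if "refines V Q S" "refines V S Q'" for S
    using that
  proof (induction "card S" arbitrary: S rule: less_induct)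
    case less
    have pS: "partition_on V S" and pQ': "partition_on V Q'"
      using less.prems by (auto simp: refines_def)
    show ?case
    proof (cases "S = Q'")
      case False
      have "\<not> S \<subseteq> Q'"
      proof
        assume "S \<subseteq> Q'"
        have "Y \<in> S" if YQ': "Y \<in> Q'" for Y
        proof -
          obtain y where y: "y \<in> Y" using partition_on_part_nonempty[OF pQ' YQ'] by blast
          then obtain X where X: "X \<in> S" "y \<in> X"
            using partition_on_part_subset[OF pQ' YQ'] partition_on_cover[OF pS] by blast
          then have "X = Y"
            using \<open>S \<subseteq> Q'\<close> partition_on_part_unique[OF pQ' _ YQ' X(2) y] by blast
          then show ?thesis using X(1) by simp
        qed
        then show False using False \<open>S \<subseteq> Q'\<close> by blast
      qed
      then obtain X where X: "X \<in> S" "X \<notin> Q'" by blast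
      then obtain Y where Y: "Y \<in> Q'" "X \<subseteq> Y" using less.prems by (auto simp: refines_def)
      then have "X \<noteq> Y" using X(2) by blast
      then obtain y where y: "y \<in> Y" "y \<notin> X" using Y(2) by blast
      then obtain Z where Z: "Z \<in> S" "y \<in> Z"
        using Y(1) partition_on_part_subset[OF pQ'] partition_on_cover[OF pS] by blast
      have ZY: "Z \<subseteq> Y" using refines_part_subset[OF less.prems(2)] Z Y y by blast
      have XZ: "X \<noteq> Z" using y Z by blast
      define T where "T = insert (X \<union> Z) (S - {X, Z})"
      have m: "merges S T" unfolding merges_def T_def using X Z XZ by blast
      have ST: "refines V S T" by (rule refines_merge[OF pS m])
      have TQ': "refines V T Q'"
        using ST less.prems(2) Y ZY unfolding refines_def T_def by auto
      have fS: "finite S" using assms(1) pS by (rule finite_elements)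
      have "card T < card S"
      proof -
        have "card T \<le> Suc (card (S - {X, Z}))"
          unfolding T_def by (simp add: card_insert_if fS)
        moreover have "card (S - {X, Z}) = card S - 2" "card S \<ge> 2"
          using X Z XZ fS card_mono[OF fS, of "{X, Z}"] by (auto simp: card_Diff_subset)
        ultimately show ?thesis by linarith
      qed
      moreover have QT: "refines V Q T" using refines_trans less.prems(1) ST by blast
      ultimately have "step\<^sup>*\<^sup>* T Q'" using less.hyps TQ' by blast
      moreover have "step S T" unfolding step_def using m QT TQ' by blast
      ultimately show ?thesis by (rule converse_rtranclp_into_rtranclp[rotated])
    qed simp
  qed
  then show ?thesis
    using assms(2) refines_refl unfolding step_def refines_def by blast
qed

text \<open>A chain of merges becomes an indexed contraction sequence. The predicate \<open>\<phi>\<close> carries along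
  what is known about every partition on the way, such as a bound on its red degrees.\<close>

lemma contraction_sequence_of_merges:
  assumes "(\<lambda>X Y. merges X Y \<and> \<phi> Y)\<^sup>*\<^sup>* (singletons (pverts G)) Q"
    and "card Q \<le> 1" "\<phi> (singletons (pverts G))"
  shows "\<exists>n P. contraction_sequence G n P \<and> (\<forall>t\<in>{1..n}. \<phi> (P t))"
proof -
  obtain n f where f: "f 0 = singletons (pverts G)" "f n = Q"
      and step: "\<And>i. i < n \<Longrightarrow> merges (f i) (f (Suc i)) \<and> \<phi> (f (Suc i))"
    using assms(1) unfolding rtranclp_power relpowp_fun_conv by blast
  have p: "i \<le> n \<Longrightarrow> partition_on (pverts G) (f i) \<and> \<phi> (f i)" for i
  proof (induction i)
    case 0
    then show ?case
      using f(1) assms(3) partition_on_singletons by (simp add: singletons_def)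
  next
    case (Suc i)
    then have "refines (pverts G) (f i) (f (Suc i))" "\<phi> (f (Suc i))"
      using step[of i] refines_merge by auto
    then show ?case by (simp add: refines_def)
  qed
  \<comment> \<open>contraction sequences are indexed from 1\<close>
  define P where "P t = f (t - 1)" for t
  have "contraction_sequence G (Suc n) P"
    unfolding contraction_sequence_def
  proof (intro conjI ballI)
    show "\<exists>A\<in>P t. \<exists>B\<in>P t. A \<noteq> B \<and> P (Suc t) = insert (A \<union> B) (P t - {A, B})"
      if "t \<in> {1..<Suc n}" for t
      using step[of "t - 1"] that unfolding P_def merges_def by auto
  qed (use f assms(2) p in \<open>auto simp: P_def\<close>)
  moreover have "\<forall>t\<in>{1..Suc n}. \<phi> (P t)" using p by (auto simp: P_def)
  ultimately show ?thesis by blast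
qed

section \<open>The twin-width of a finite graph is attained\<close>

lemma pair_graph_finite_verts:
  assumes "pair_graph G"
  shows "finite (pverts G)"
  using assms
  by (meson pair_fin_digraph.pair_finite_verts pair_digraph.axioms(1) pair_graph.axioms(1))

lemma twin_width_le:
  assumes "contraction_sequence G n P" "\<forall>t\<in>{1..n}. max_degree_at_most (red_graph G (P t)) d"
  shows "twin_width G \<le> d"
  unfolding twin_width_def by (rule Least_le) (use assms in blast)

text \<open>Removing the empty set makes this the coarsest partition of the empty set as well.\<close>

lemma refines_trivial_partition:
  assumes "partition_on V Q"
  shows "refines V Q ({V} - {{}})"
proof -
  have "partition_on V ({V} - {{}})"
    by (cases "V = {}") (auto simp: partition_on_empty partition_on_space)
  then show ?thesis
    using assms partition_onD1[OF assms] partition_onD3[OF assms] unfolding refines_def by auto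
qed

text \<open>A least value says something only if some value is possible at all: in a finite graph the
  red degrees are bounded by the number of vertex sets, whatever the contraction sequence.\<close>

lemma twin_width_attained:
  assumes "finite (pverts G)"
  shows "\<exists>n P. contraction_sequence G n P \<and>
    (\<forall>t\<in>{1..n}. max_degree_at_most (red_graph G (P t)) (twin_width G))"
proof -
  let ?V = "pverts G"
  let ?d = "card (Pow ?V)"
  let ?ok = "\<lambda>Y. partition_on ?V Y"
  have ref: "refines ?V (singletons ?V) ({?V} - {{}})"
    unfolding singletons_def by (intro refines_trivial_partition partition_on_singletons)
  have "(\<lambda>X Y. merges X Y \<and> ?ok Y)\<^sup>*\<^sup>* (singletons ?V) ({?V} - {{}})"
    by (rule rtranclp_mono[THEN predicate2D, OF _ merges_between[OF assms ref]])
      (auto simp: refines_def)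
  moreover have "card ({?V} - {{}}) \<le> 1"
    by (metis Diff_subset card.empty card_insert_disjoint card_mono empty_iff finite.simps One_nat_def)
  moreover have "?ok (singletons ?V)"
    unfolding singletons_def by (rule partition_on_singletons)
  ultimately obtain n P where nP: "contraction_sequence G n P" "\<forall>t\<in>{1..n}. ?ok (P t)"
    using contraction_sequence_of_merges[of ?ok G] by blast
  have "max_degree_at_most (red_graph G (P t)) ?d" if "t \<in> {1..n}" for t
    unfolding max_degree_at_most_def
  proof
    fix A
    have "{B. (A, B) \<in> parcs (red_graph G (P t))} \<subseteq> Pow ?V"
      using nP(2) that partition_onD1 by (fastforce simp: red_graph_def)
    then show "card {B. (A, B) \<in> parcs (red_graph G (P t))} \<le> ?d"
      using assms by (intro card_mono) auto
  qed
  then have "\<exists>d n P. contraction_sequence G n P \<and>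
      (\<forall>t\<in>{1..n}. max_degree_at_most (red_graph G (P t)) d)"
    using nP(1) by blast
  then show ?thesis unfolding twin_width_def by (rule LeastI_ex)
qed

section \<open>From merge sequences of ordered graphs to contraction sequences\<close>

lemma merge_sequenceD:
  assumes "merge_sequence H m P R"
  shows "1 \<le> m"
    and "t \<in> {1..m} \<Longrightarrow> partition_on (pverts (fst H)) (P t)"
    and "P 1 = singletons (pverts (fst H))"
    and "card (P m) \<le> 1"
    and "t \<in> {2..m} \<Longrightarrow> refines (pverts (fst H)) (P (t - 1)) (P t)"
    and "\<lbrakk>t \<in> {1..m}; A \<in> P t; B \<in> P t; S \<in> {parcs (fst H), snd H}\<rbrakk> \<Longrightarrow>
      (\<forall>a\<in>A. \<forall>b\<in>B. a \<noteq> b \<and> {a, b} \<notin> R t \<longrightarrow> (a, b) \<in> S) \<or>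
      (\<forall>a\<in>A. \<forall>b\<in>B. a \<noteq> b \<and> {a, b} \<notin> R t \<longrightarrow> (a, b) \<notin> S)"
proof -
  note D = assms[unfolded merge_sequence_def Let_def]
  show "1 \<le> m" "P 1 = singletons (pverts (fst H))" "card (P m) \<le> 1"
    using D by - (elim conjE, assumption)+
  have part: "\<forall>t\<in>{1..m}. partition_on (pverts (fst H)) (P t)"
    and chain: "\<forall>t\<in>{2..m}. refines (pverts (fst H)) (P (t - 1)) (P t)"
    and hom: "\<forall>t\<in>{1..m}. \<forall>A\<in>P t. \<forall>B\<in>P t. \<forall>S\<in>{parcs (fst H), snd H}.
      (\<forall>a\<in>A. \<forall>b\<in>B. a \<noteq> b \<and> {a, b} \<notin> R t \<longrightarrow> (a, b) \<in> S) \<or>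
      (\<forall>a\<in>A. \<forall>b\<in>B. a \<noteq> b \<and> {a, b} \<notin> R t \<longrightarrow> (a, b) \<notin> S)"
    using D by - (elim conjE, assumption)+
  show "partition_on (pverts (fst H)) (P t)" if "t \<in> {1..m}"
    using part that by blast
  show "refines (pverts (fst H)) (P (t - 1)) (P t)" if "t \<in> {2..m}"
    using chain that by blast
  show "(\<forall>a\<in>A. \<forall>b\<in>B. a \<noteq> b \<and> {a, b} \<notin> R t \<longrightarrow> (a, b) \<in> S) \<or>
      (\<forall>a\<in>A. \<forall>b\<in>B. a \<noteq> b \<and> {a, b} \<notin> R t \<longrightarrow> (a, b) \<notin> S)"
    if "t \<in> {1..m}" "A \<in> P t" "B \<in> P t" "S \<in> {parcs (fst H), snd H}"
    using that by (rule hom[THEN bspec, THEN bspec, THEN bspec, THEN bspec])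
qed

lemma finite_radius_counts:
  fixes m :: nat
  assumes "finite (pverts (fst H))"
  shows "finite (insert 0 {card {A \<in> P (t - 1). \<exists>u\<in>A. reachable_within (R t) r v u} |t v.
    t \<in> {2..m} \<and> v \<in> pverts (fst H)})"
  unfolding finite_insert by (rule finite_image_set2) (use assms in auto)

text \<open>This is where the order matters. Of the two pairs \<open>(a, b)\<close> and \<open>(b, a)\<close> exactly one
  belongs to a strict linear order, so no part with two vertices is homogeneous to itself with
  respect to it, and every pair inside a part must have been resolved.\<close>

lemma part_resolved_clique:
  assumes "ordered_graph H" "merge_sequence H m P R" "t \<in> {1..m}"
    and "A \<in> P t" "a \<in> A" "b \<in> A" "a \<noteq> b"
  shows "{a, b} \<in> R t"
proof (rule ccontr)
  assume n: "{a, b} \<notin> R t"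
  have "a \<in> pverts (fst H)" "b \<in> pverts (fst H)"
    using partition_onD1[OF merge_sequenceD(2)[OF assms(2,3)]] assms(4-6) by auto
  moreover have lin: "strict_linear_order_on (pverts (fst H)) (snd H)"
    using assms(1) by (simp add: ordered_graph_def)
  ultimately have "(a, b) \<in> snd H \<or> (b, a) \<in> snd H"
    using assms(7) by (auto simp: strict_linear_order_on_def total_on_def)
  moreover have "\<not> ((a, b) \<in> snd H \<and> (b, a) \<in> snd H)"
    using lin by (meson strict_linear_order_on_def irrefl_def transD)
  moreover have "(a, b) \<in> snd H \<longleftrightarrow> (b, a) \<in> snd H"
  proof -
    have n': "{b, a} \<notin> R t" using n by (simp add: insert_commute)
    have "(\<forall>a\<in>A. \<forall>b\<in>A. a \<noteq> b \<and> {a, b} \<notin> R t \<longrightarrow> (a, b) \<in> snd H) \<or>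
      (\<forall>a\<in>A. \<forall>b\<in>A. a \<noteq> b \<and> {a, b} \<notin> R t \<longrightarrow> (a, b) \<notin> snd H)"
      by (rule merge_sequenceD(6)[OF assms(2,3,4,4)]) simp
    then show ?thesis
    proof
      assume "\<forall>a\<in>A. \<forall>b\<in>A. a \<noteq> b \<and> {a, b} \<notin> R t \<longrightarrow> (a, b) \<in> snd H"
      then have "(a, b) \<in> snd H" "(b, a) \<in> snd H" using n n' assms(5-7) by auto
      then show ?thesis by simp
    next
      assume "\<forall>a\<in>A. \<forall>b\<in>A. a \<noteq> b \<and> {a, b} \<notin> R t \<longrightarrow> (a, b) \<notin> snd H"
      then have "(a, b) \<notin> snd H" "(b, a) \<notin> snd H" using n n' assms(5-7) by auto
      then show ?thesis by simp
    qed
  qed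
  ultimately show False by blast
qed

lemma reachable_within_2:
  assumes "v = a \<or> {v, a} \<in> F" "{a, b} \<in> F" "a \<noteq> b"
  shows "reachable_within F 2 v b"
proof -
  consider "v = b" | "v \<noteq> b" "v = a" | "v \<noteq> b" "v \<noteq> a" by blast
  then show ?thesis
  proof cases
    case 1
    then show ?thesis unfolding reachable_within_def by (intro exI[of _ "[v]"]) auto
  next
    case 2
    then show ?thesis unfolding reachable_within_def
      using assms by (intro exI[of _ "[v, b]"]) auto
  next
    case 3
    then show ?thesis unfolding reachable_within_def
      using assms by (intro exI[of _ "[v, a, b]"]) auto
  qed
qed

text \<open>A red edge between parts \<open>A\<close> and \<open>B\<close> of \<open>Q\<close> comes from a resolved pair \<open>{a, b}\<close>. Since the
  part of \<open>P t\<close> around \<open>A\<close> is a clique of resolved pairs, every vertex \<open>v\<close> of \<open>A\<close> is equal or adjacent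
  to \<open>a\<close>, so one fixed \<open>v\<close> sees all red neighbours of \<open>A\<close> at distance at most 2. The part of
  \<open>P (t - 1)\<close> around \<open>b\<close> lies inside \<open>B\<close>, so distinct red neighbours are counted separately.\<close>

lemma red_degree_le_radius_2_width:
  assumes og: "ordered_graph H" and ms: "merge_sequence H m P R" and t: "t \<in> {2..m}"
    and PQ: "refines (pverts (fst H)) (P (t - 1)) Q" and QP: "refines (pverts (fst H)) Q (P t)"
  shows "max_degree_at_most (red_graph (fst H) Q) (radius_width 2 H m P R)"
  unfolding max_degree_at_most_def
proof
  let ?V = "pverts (fst H)"
  fix A assume "A \<in> pverts (red_graph (fst H) Q)"
  then have A: "A \<in> Q" by (simp add: red_graph_def)
  have t1: "t \<in> {1..m}" using t by auto
  have fV: "finite ?V"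
    using og by (simp add: ordered_graph_def pair_graph_finite_verts)
  have pQ: "partition_on ?V Q" and p1: "partition_on ?V (P (t - 1))"
    using PQ by (auto simp: refines_def)
  obtain v where v: "v \<in> A" using partition_on_part_nonempty[OF pQ A] by blast
  have vV: "v \<in> ?V" using v A pQ partition_onD1 by blast
  obtain A' where A': "A' \<in> P t" "A \<subseteq> A'" using QP A by (auto simp: refines_def)
  let ?N = "{B. (A, B) \<in> parcs (red_graph (fst H) Q)}"
  let ?S = "{X \<in> P (t - 1). \<exists>u\<in>X. reachable_within (R t) 2 v u}"
  have "\<exists>X\<in>?S. X \<subseteq> B" if "B \<in> ?N" for B
  proof -
    have B: "B \<in> Q" "A \<noteq> B" and nh: "\<not> homogeneous (fst H) A B"
      using that by (auto simp: red_graph_def)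
    obtain B' where B': "B' \<in> P t" "B \<subseteq> B'" using QP B by (auto simp: refines_def)
    obtain a b where ab: "a \<in> A" "b \<in> B" "a \<noteq> b" "{a, b} \<in> R t"
      using merge_sequenceD(6)[OF ms t1 A'(1) B'(1), of "parcs (fst H)"] A'(2) B'(2) nh
      unfolding homogeneous_def by blast
    have "v = a \<or> {v, a} \<in> R t"
      using part_resolved_clique[OF og ms t1 A'(1)] v ab(1) A'(2) by blast
    then have reach: "reachable_within (R t) 2 v b" using ab reachable_within_2 by metis
    have "b \<in> ?V" using ab B pQ partition_onD1 by blast
    then obtain X where X: "X \<in> P (t - 1)" "b \<in> X" using p1 partition_onD1 by blast
    have "X \<subseteq> B" using refines_part_subset[OF PQ X(1) B(1) X(2) ab(2)] .
    then show ?thesis using X reach by blast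
  qed
  then have "\<forall>B\<in>?N. \<exists>X. X \<in> ?S \<and> X \<subseteq> B" by blast
  then obtain g where g: "\<forall>B\<in>?N. g B \<in> ?S \<and> g B \<subseteq> B" by (rule bchoice[THEN exE])
  have "inj_on g ?N"
  proof (rule inj_onI)
    fix B C assume BC: "B \<in> ?N" "C \<in> ?N" "g B = g C"
    have "g B \<in> P (t - 1)" using g BC(1) by blast
    then obtain x where "x \<in> g B" using partition_on_part_nonempty[OF p1] by blast
    then have "x \<in> B" "x \<in> C" using g BC by blast+
    moreover have "B \<in> Q" "C \<in> Q" using BC by (auto simp: red_graph_def)
    ultimately show "B = C" using partition_on_part_unique[OF pQ] by blast
  qed
  moreover have "g ` ?N \<subseteq> ?S" using g by blast
  moreover have "finite ?S" using finite_elements[OF fV p1] by simp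
  ultimately have "card ?N \<le> card ?S" by (rule card_inj_on_le)
  also have "\<dots> \<le> radius_width 2 H m P R"
    unfolding radius_width_def by (rule Max_ge[OF finite_radius_counts[OF fV]]) (use t vV in blast)
  finally show "card ?N \<le> radius_width 2 H m P R" .
qed

text \<open>The stages of the merge sequence serve as checkpoints of the contraction sequence: between two
  consecutive ones the parts are merged one pair at a time, and each partition on the way is covered
  by the previous bound.\<close>

lemma twin_width_le_radius_2_width:
  assumes og: "ordered_graph H" and ms: "merge_sequence H m P R"
  shows "twin_width (fst H) \<le> radius_width 2 H m P R"
proof -
  let ?V = "pverts (fst H)"
  define \<phi> where "\<phi> Q \<longleftrightarrow> max_degree_at_most (red_graph (fst H) Q) (radius_width 2 H m P R)" for Q
  have fV: "finite ?V"
    using og by (simp add: ordered_graph_def pair_graph_finite_verts)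
  have "homogeneous (fst H) A B" if "A \<in> singletons ?V" "B \<in> singletons ?V" for A B
    using that by (auto simp: singletons_def homogeneous_def)
  then have "{B. (A, B) \<in> parcs (red_graph (fst H) (singletons ?V))} = {}" for A
    by (auto simp: red_graph_def)
  then have base: "\<phi> (singletons ?V)"
    unfolding \<phi>_def max_degree_at_most_def by simp
  have "(\<lambda>X Y. merges X Y \<and> \<phi> Y)\<^sup>*\<^sup>* (singletons ?V) (P (Suc i))" if "Suc i \<le> m" for i
    using that
  proof (induction i)
    case 0
    then show ?case using merge_sequenceD(3)[OF ms] by simp
  next
    case (Suc i)
    let ?t = "Suc (Suc i)"
    have t: "?t \<in> {2..m}" using Suc.prems by auto
    have "(\<lambda>X Y. merges X Y \<and> \<phi> Y)\<^sup>*\<^sup>* (P (Suc i)) (P ?t)"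
      by (rule rtranclp_mono[THEN predicate2D,
            OF _ merges_between[OF fV merge_sequenceD(5)[OF ms t, simplified]]])
        (use red_degree_le_radius_2_width[OF og ms t] in \<open>auto simp: \<phi>_def\<close>)
    then show ?case using Suc by (meson Suc_leD rtranclp_trans)
  qed
  from this[of "m - 1"] have "(\<lambda>X Y. merges X Y \<and> \<phi> Y)\<^sup>*\<^sup>* (singletons ?V) (P m)"
    using merge_sequenceD(1)[OF ms] by simp
  then obtain n P' where "contraction_sequence (fst H) n P'" "\<forall>t\<in>{1..n}. \<phi> (P' t)"
    using contraction_sequence_of_merges[of \<phi> "fst H" "P m"] merge_sequenceD(4)[OF ms] base by blast
  then show ?thesis unfolding \<phi>_def by (rule twin_width_le)
qed

text \<open>The trivial merge sequence, which resolves everything and then joins all vertices at once,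
  shows that the minimum in the definition of merge-width is taken over a nonempty set.\<close>

lemma merge_width_attained:
  assumes "ordered_graph H"
  shows "\<exists>m P R. merge_sequence H m P R \<and> radius_width r H m P R = merge_width r H"
proof -
  let ?V = "pverts (fst H)"
  define P where "P t = (if t = 1 then singletons ?V else {?V} - {{}})" for t :: nat
  define R where "R t = (if t = 1 then {} else nsets ?V 2)" for t :: nat
  have ref: "refines ?V (singletons ?V) ({?V} - {{}})"
    unfolding singletons_def by (intro refines_trivial_partition partition_on_singletons)
  have "merge_sequence H 2 P R"
    unfolding merge_sequence_def Let_def
  proof (intro conjI ballI)
    show "partition_on ?V (P t)" for t
      using ref by (auto simp: P_def refines_def)
    show "card (P 2) \<le> 1"
      by (cases "?V = {}") (auto simp: P_def)
    show "refines ?V (P (t - 1)) (P t)" if "t \<in> {2..2}" for t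
      using that ref by (simp add: P_def)
    fix t A B S assume "t \<in> {1..2::nat}" and A: "A \<in> P t" and B: "B \<in> P t"
    show "(\<forall>a\<in>A. \<forall>b\<in>B. a \<noteq> b \<and> {a, b} \<notin> R t \<longrightarrow> (a, b) \<in> S) \<or>
      (\<forall>a\<in>A. \<forall>b\<in>B. a \<noteq> b \<and> {a, b} \<notin> R t \<longrightarrow> (a, b) \<notin> S)"
    proof (cases "t = 1")
      case True
      then show ?thesis using A B by (auto simp: P_def singletons_def)
    next
      case False
      then show ?thesis using A B by (auto simp: P_def R_def nsets_def card_2_iff)
    qed
  qed (auto simp: P_def R_def)
  then have "\<exists>w m P R. merge_sequence H m P R \<and> radius_width r H m P R = w" by blast
  then show ?thesis unfolding merge_width_def by (rule LeastI_ex)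
qed

section \<open>An order for which all parts are intervals\<close>

text \<open>Number the parts arbitrarily and compare two vertices by the numbers of the parts that contain
  them, lexicographically from the coarsest partition to the finest. For distinct parts \<open>A\<close> and \<open>B\<close> of
  \<open>P t\<close> the comparison is decided at stage \<open>t\<close> or at a coarser one, and there all of \<open>A\<close> lies in one
  part and all of \<open>B\<close> in one part.\<close>

lemma order_homogeneous_on_partition_chain:
  fixes P :: "nat \<Rightarrow> 'a set set"
  assumes fin: "finite V" and n: "1 \<le> n"
    and part: "\<And>t. t \<in> {1..n} \<Longrightarrow> partition_on V (P t)"
    and P1: "P 1 = singletons V"
    and chain: "\<And>t. t \<in> {1..<n} \<Longrightarrow> refines V (P t) (P (Suc t))"
  shows "\<exists>L \<subseteq> V \<times> V. strict_linear_order_on V L \<and>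
    (\<forall>t\<in>{1..n}. \<forall>A\<in>P t. \<forall>B\<in>P t. A \<noteq> B \<longrightarrow> A \<times> B \<subseteq> L \<or> A \<times> B \<inter> L = {})"
proof -
  obtain g :: "'a set \<Rightarrow> nat" where g: "inj_on g (Pow V)"
    using fin finite_imp_inj_to_nat_seg[of "Pow V"] by auto
  define key where "key t u = g (THE X. X \<in> P t \<and> u \<in> X)" for t u
  have key: "key t u = g X" if "t \<in> {1..n}" "X \<in> P t" "u \<in> X" for t u X
  proof -
    have "(THE X. X \<in> P t \<and> u \<in> X) = X"
      using that partition_on_part_unique[OF part[OF that(1)]] by (intro the_equality) auto
    then show ?thesis by (simp add: key_def)
  qed
  have coarser: "refines V (P t) (P s)" if "t \<in> {1..n}" "t \<le> s" "s \<le> n" for s t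
    using that(2,3)
  proof (induction s rule: dec_induct)
    case base
    then show ?case using refines_refl part that by blast
  next
    case (step s)
    then show ?case using chain[of s] that(1) by (auto intro: refines_trans)
  qed
  have key_eq: "key s u = key s u'"
    if "t \<in> {1..n}" "A \<in> P t" "u \<in> A" "u' \<in> A" "t \<le> s" "s \<le> n" for s t A u u'
  proof -
    have "\<exists>X\<in>P s. A \<subseteq> X"
      using coarser[OF that(1,5,6)] that(2) by (auto simp: refines_def)
    then obtain X where X: "X \<in> P s" "A \<subseteq> X" by blast
    have "s \<in> {1..n}" using that(1,5,6) by auto
    moreover have "u \<in> X" "u' \<in> X" using X(2) that(3,4) by auto
    ultimately show ?thesis using key X(1) by simp
  qed
  have key_neq: "key t u \<noteq> key t w"
    if "t \<in> {1..n}" "A \<in> P t" "B \<in> P t" "A \<noteq> B" "u \<in> A" "w \<in> B" for t A B u w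
  proof -
    have "A \<in> Pow V" "B \<in> Pow V"
      using that(2,3) partition_on_part_subset[OF part[OF that(1)]] by auto
    then show ?thesis
      using key[OF that(1,2,5)] key[OF that(1,3,6)] inj_on_eq_iff[OF g] that(4) by simp
  qed
  define below where "below u w \<longleftrightarrow>
    (\<exists>t\<in>{1..n}. key t u < key t w \<and> (\<forall>s\<in>{t<..n}. key s u = key s w))" for u w
  define L where "L = {(u, w). u \<in> V \<and> w \<in> V \<and> below u w}"
  have "trans L"
  proof (rule transI)
    fix u v w assume "(u, v) \<in> L" "(v, w) \<in> L"
    then obtain s t where V: "u \<in> V" "w \<in> V"
      and s: "s \<in> {1..n}" "key s u < key s v" "\<And>i. i \<in> {s<..n} \<Longrightarrow> key i u = key i v"
      and t: "t \<in> {1..n}" "key t v < key t w" "\<And>i. i \<in> {t<..n} \<Longrightarrow> key i v = key i w"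
      unfolding L_def below_def by blast
    \<comment> \<open>the coarser of the two deciding stages decides between \<open>u\<close> and \<open>w\<close>\<close>
    have "key (max s t) u < key (max s t) w"
      using s t by (cases s t rule: linorder_cases) (auto simp: max_def)
    moreover have "key i u = key i w" if "i \<in> {max s t<..n}" for i
      using s(3)[of i] t(3)[of i] that by auto
    ultimately have "below u w"
      unfolding below_def using s(1) t(1) by (intro bexI[of _ "max s t"]) auto
    then show "(u, w) \<in> L" using V by (simp add: L_def)
  qed
  moreover have "irrefl L" by (auto simp: irrefl_def L_def below_def)
  moreover have "total_on V L"
    unfolding total_on_def
  proof (intro ballI impI)
    fix u w assume uw: "u \<in> V" "w \<in> V" "u \<noteq> w"
    \<comment> \<open>the coarsest stage at which \<open>u\<close> and \<open>w\<close> are in different parts\<close>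
    define t where "t = Max {s \<in> {1..n}. key s u \<noteq> key s w}"
    have "key 1 u \<noteq> key 1 w"
      using key_neq[of 1 "{u}" "{w}"] uw n P1 by (auto simp: singletons_def)
    then have "{s \<in> {1..n}. key s u \<noteq> key s w} \<noteq> {}" using n by auto
    then have "t \<in> {s \<in> {1..n}. key s u \<noteq> key s w}" unfolding t_def by (intro Max_in) auto
    moreover have "key s u = key s w" if "s \<in> {t<..n}" for s
      using Max_ge[of "{s \<in> {1..n}. key s u \<noteq> key s w}" s] that unfolding t_def[symmetric] by force
    ultimately show "(u, w) \<in> L \<or> (w, u) \<in> L"
      using uw unfolding L_def below_def by (force simp: neq_iff)
  qed
  ultimately have lin: "strict_linear_order_on V L" by (simp add: strict_linear_order_on_def)
  have "A \<times> B \<subseteq> L \<or> A \<times> B \<inter> L = {}"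
    if t: "t \<in> {1..n}" and A: "A \<in> P t" and B: "B \<in> P t" and AB: "A \<noteq> B" for t A B
  proof -
    have V: "A \<subseteq> V" "B \<subseteq> V"
      using A B partition_on_part_subset[OF part[OF t]] by auto
    have "below a' b'" if "a \<in> A" "b \<in> B" "a' \<in> A" "b' \<in> B" "below a b" for a b a' b'
    proof -
      obtain s where s: "s \<in> {1..n}" "key s a < key s b" "\<And>i. i \<in> {s<..n} \<Longrightarrow> key i a = key i b"
        using \<open>below a b\<close> unfolding below_def by blast
      \<comment> \<open>\<open>a\<close> and \<open>b\<close> already differ at stage \<open>t\<close>, so no finer stage can decide between them\<close>
      have "t \<le> s"
        using key_neq[OF t A B AB that(1,2)] s(3)[of t] t by force
      moreover have "key i a' = key i a" "key i b' = key i b" if "t \<le> i" "i \<le> n" for i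
        using key_eq[OF t A _ _ that] key_eq[OF t B _ _ that] \<open>a \<in> A\<close> \<open>a' \<in> A\<close> \<open>b \<in> B\<close> \<open>b' \<in> B\<close>
        by blast+
      ultimately show ?thesis
        unfolding below_def using s by (intro bexI[of _ s]) auto
    qed
    then show ?thesis using V unfolding L_def by blast
  qed
  moreover have "L \<subseteq> V \<times> V" by (auto simp: L_def)
  ultimately show ?thesis using lin by blast
qed

section \<open>From contraction sequences to merge sequences of ordered graphs\<close>

text \<open>The pairs inside the parts belong here because of the order, on which no part with two vertices
  is homogeneous to itself.\<close>

definition resolved_pairs :: "'a pair_pre_digraph \<Rightarrow> 'a set set \<Rightarrow> 'a set set" where
  "resolved_pairs G Q =
     {{a, b} |a b A B. A \<in> Q \<and> B \<in> Q \<and> a \<in> A \<and> b \<in> B \<and> a \<noteq> b \<and> (A = B \<or> \<not> homogeneous G A B)}"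

text \<open>Enlarging two parts that are not homogeneous keeps them so, unless they become equal.\<close>

lemma resolved_pairs_mono:
  assumes "refines V Q Q'"
  shows "resolved_pairs G Q \<subseteq> resolved_pairs G Q'"
proof
  fix e assume "e \<in> resolved_pairs G Q"
  then obtain a b A B where e: "e = {a, b}" "A \<in> Q" "B \<in> Q" "a \<in> A" "b \<in> B" "a \<noteq> b"
    "A = B \<or> \<not> homogeneous G A B"
    unfolding resolved_pairs_def by blast
  obtain A' where A': "A' \<in> Q'" "A \<subseteq> A'" using assms e by (auto simp: refines_def)
  obtain B' where B': "B' \<in> Q'" "B \<subseteq> B'" using assms e by (auto simp: refines_def)
  have "A' = B' \<or> \<not> homogeneous G A' B'"
  proof (cases "A = B")
    case True
    then show ?thesis
      using partition_on_part_unique[of V Q' A' B' a] assms A' B' e by (auto simp: refines_def)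
  next
    case False
    then show ?thesis using e(7) A' B' unfolding homogeneous_def by blast
  qed
  then show "e \<in> resolved_pairs G Q'" unfolding resolved_pairs_def using e A' B' by blast
qed

lemma homogeneous_commute:
  assumes "pair_graph G"
  shows "homogeneous G A B \<longleftrightarrow> homogeneous G B A"
proof -
  interpret pair_graph G by (rule assms)
  have sym: "(x, y) \<in> parcs G \<longleftrightarrow> (y, x) \<in> parcs G" for x y
    using arcs_symmetric by blast
  have "homogeneous G Y X" if "homogeneous G X Y" for X Y
  proof -
    from that consider "\<forall>a\<in>X. \<forall>b\<in>Y. a \<noteq> b \<longrightarrow> (a, b) \<in> parcs G"
      | "\<forall>a\<in>X. \<forall>b\<in>Y. a \<noteq> b \<longrightarrow> (a, b) \<notin> parcs G"
      unfolding homogeneous_def by blast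
    then show ?thesis
    proof cases
      case 1
      have "(b, a) \<in> parcs G" if "b \<in> Y" "a \<in> X" "b \<noteq> a" for a b
        using 1 that sym[of a b] by auto
      then show ?thesis by (simp add: homogeneous_def)
    next
      case 2
      have "(b, a) \<notin> parcs G" if "b \<in> Y" "a \<in> X" "b \<noteq> a" for a b
        using 2 that sym[of a b] by auto
      then show ?thesis by (simp add: homogeneous_def)
    qed
  qed
  then show ?thesis by blast
qed

lemma reachable_within_Suc:
  assumes "reachable_within F (Suc r) v u"
  shows "reachable_within F r v u \<or> (\<exists>w. reachable_within F r v w \<and> {w, u} \<in> F)"
proof -
  obtain p where p: "p \<noteq> []" "hd p = v" "last p = u" "distinct p"
    "successively (\<lambda>x y. {x, y} \<in> F) p" "length p - 1 \<le> Suc r"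
    using assms unfolding reachable_within_def by blast
  obtain q where q: "p = q @ [u]" using p(1,3) by (metis append_butlast_last_id)
  show ?thesis
  proof (cases "q = []")
    case True
    then show ?thesis
      unfolding reachable_within_def using p q by (intro disjI1 exI[of _ "[u]"]) auto
  next
    case False
    have "reachable_within F r v (last q)"
      unfolding reachable_within_def using False p q
      by (intro exI[of _ q]) (auto simp: successively_append_iff)
    moreover have "{last q, u} \<in> F" using False p q by (auto simp: successively_append_iff)
    ultimately show ?thesis by blast
  qed
qed

text \<open>Each resolved edge stays inside a part or follows a red edge, so the parts that are met by a
  ball of radius \<open>r\<close> lie within a ball of radius \<open>r\<close> in the red graph.\<close>

lemma card_parts_reachable:
  assumes G: "pair_graph G" and p: "partition_on (pverts G) Q"
    and deg: "max_degree_at_most (red_graph G Q) d"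
  shows "card {X \<in> Q. \<exists>u\<in>X. reachable_within (resolved_pairs G Q) r v u} \<le> (d + 1) ^ r"
proof -
  have fin: "finite Q"
    using finite_elements[OF pair_graph_finite_verts[OF G] p] .
  show ?thesis
  proof (induction r)
    case 0
    have "X = Y" if "X \<in> Q" "Y \<in> Q" "u \<in> X" "w \<in> Y"
      "reachable_within (resolved_pairs G Q) 0 v u" "reachable_within (resolved_pairs G Q) 0 v w"
      for X Y u w
    proof -
      have "u' = v" if "reachable_within (resolved_pairs G Q) 0 v u'" for u'
        using that unfolding reachable_within_def by (auto simp: le_Suc_eq length_Suc_conv)
      then show ?thesis using that partition_on_part_unique[OF p] by blast
    qed
    then show ?case by (auto simp: card_le_Suc0_iff_eq fin)
  next
    case (Suc r)
    let ?F = "resolved_pairs G Q"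
    let ?S = "\<lambda>r. {X \<in> Q. \<exists>u\<in>X. reachable_within ?F r v u}"
    let ?N = "\<lambda>X. insert X {Y. (X, Y) \<in> parcs (red_graph G Q)}"
    have "?S (Suc r) \<subseteq> (\<Union>X\<in>?S r. ?N X)"
    proof
      fix Y assume "Y \<in> ?S (Suc r)"
      then obtain u where Y: "Y \<in> Q" "u \<in> Y" and "reachable_within ?F (Suc r) v u" by blast
      from reachable_within_Suc[OF this(3)] consider "reachable_within ?F r v u"
        | w where "reachable_within ?F r v w" "{w, u} \<in> ?F" by blast
      then show "Y \<in> (\<Union>X\<in>?S r. ?N X)"
      proof cases
        case 1
        then show ?thesis using Y by blast
      next
        case 2
        have "\<exists>X\<in>Q. \<exists>Z\<in>Q. w \<in> X \<and> u \<in> Z \<and> (X = Z \<or> \<not> homogeneous G X Z)"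
          using 2(2) homogeneous_commute[OF G] unfolding resolved_pairs_def
          by (auto simp: doubleton_eq_iff)
        then obtain X where "X \<in> Q" "w \<in> X" "X = Y \<or> \<not> homogeneous G X Y"
          using partition_on_part_unique[OF p] Y by blast
        then show ?thesis using 2(1) Y by (auto simp: red_graph_def)
      qed
    qed
    moreover have fN: "finite (?N X)" for X
      using finite_subset[OF _ fin, of "{Y. (X, Y) \<in> parcs (red_graph G Q)}"]
      by (auto simp: red_graph_def)
    ultimately have "card (?S (Suc r)) \<le> card (\<Union>X\<in>?S r. ?N X)"
      using fin by (intro card_mono) auto
    also have "\<dots> \<le> (\<Sum>X\<in>?S r. card (?N X))"
      using fin by (intro card_UN_le) auto
    also have "\<dots> \<le> (\<Sum>X\<in>?S r. d + 1)"
    proof (rule sum_mono)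
      fix X assume "X \<in> ?S r"
      then have "card {Y. (X, Y) \<in> parcs (red_graph G Q)} \<le> d"
        using deg by (auto simp: max_degree_at_most_def red_graph_def)
      then show "card (?N X) \<le> d + 1" using fN[of X] by (auto simp: card_insert_if)
    qed
    also have "\<dots> = card (?S r) * (d + 1)" by simp
    also have "\<dots> \<le> (d + 1) ^ r * (d + 1)" using Suc by (rule mult_right_mono) simp
    finally show ?case by (simp add: mult.commute)
  qed
qed

text \<open>The sets \<open>R t\<close> depend on the contraction sequence only, so one order and one merge sequence
  serve all radii. The summand 2 accounts for the two parts of \<open>P (t - 1)\<close> that are merged into a part
  of \<open>P t\<close>; every other part of \<open>P (t - 1)\<close> is also a part of \<open>P t\<close>.\<close>

lemma order_of_bounded_merge_width:
  fixes G :: "'a pair_pre_digraph"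
  assumes G: "pair_graph G" and tw: "twin_width G \<le> d"
  shows "\<exists>L. ordered_graph (G, L) \<and> (\<forall>r. merge_width r (G, L) \<le> (d + 1) ^ r + 2)"
proof -
  let ?V = "pverts G"
  have fin: "finite ?V"
    using G by (rule pair_graph_finite_verts)
  obtain n P where cs: "contraction_sequence G n P"
    and deg: "\<And>t. t \<in> {1..n} \<Longrightarrow> max_degree_at_most (red_graph G (P t)) (twin_width G)"
    using twin_width_attained[OF fin] by blast
  have n: "1 \<le> n" and part: "\<And>t. t \<in> {1..n} \<Longrightarrow> partition_on ?V (P t)"
    and P1: "P 1 = singletons ?V" and Pn: "card (P n) \<le> 1"
    and step: "\<And>t. t \<in> {1..<n} \<Longrightarrow> merges (P t) (P (Suc t))"
    using cs unfolding contraction_sequence_def merges_def by auto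
  have chain: "refines ?V (P t) (P (Suc t))" if "t \<in> {1..<n}" for t
    using refines_merge[OF part step] that by auto
  obtain L where L: "L \<subseteq> ?V \<times> ?V" "strict_linear_order_on ?V L"
    and hom: "\<forall>t\<in>{1..n}. \<forall>A\<in>P t. \<forall>B\<in>P t. A \<noteq> B \<longrightarrow> A \<times> B \<subseteq> L \<or> A \<times> B \<inter> L = {}"
    using order_homogeneous_on_partition_chain[OF fin n part P1 chain] by blast
  have og: "ordered_graph (G, L)" using G L by (simp add: ordered_graph_def)
  define R where "R t = resolved_pairs G (P t)" for t
  have chain': "refines ?V (P (t - 1)) (P t)" if "t \<in> {2..n}" for t
  proof -
    have "t - 1 \<in> {1..<n}" "Suc (t - 1) = t" using that by auto
    then show ?thesis using chain[of "t - 1"] by simp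
  qed
  have ms: "merge_sequence (G, L) n P R"
    unfolding merge_sequence_def Let_def fst_conv snd_conv
  proof (intro conjI ballI)
    show "R t \<subseteq> nsets ?V 2" if "t \<in> {1..n}" for t
      using partition_onD1[OF part[OF that]] by (auto simp: R_def resolved_pairs_def)
    show "R (t - 1) \<subseteq> R t" if "t \<in> {2..n}" for t
      unfolding R_def by (rule resolved_pairs_mono[OF chain'[OF that]])
    fix t A B S assume t: "t \<in> {1..n}" and AB: "A \<in> P t" "B \<in> P t" and S: "S \<in> {parcs G, L}"
    have R: "{a, b} \<in> R t" if "a \<in> A" "b \<in> B" "a \<noteq> b" "A = B \<or> \<not> homogeneous G A B" for a b
      unfolding R_def resolved_pairs_def using AB that by blast
    consider "A = B \<or> \<not> homogeneous G A B" | "A \<noteq> B" "homogeneous G A B" by blast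
    then show "(\<forall>a\<in>A. \<forall>b\<in>B. a \<noteq> b \<and> {a, b} \<notin> R t \<longrightarrow> (a, b) \<in> S) \<or>
      (\<forall>a\<in>A. \<forall>b\<in>B. a \<noteq> b \<and> {a, b} \<notin> R t \<longrightarrow> (a, b) \<notin> S)"
    proof cases
      case 1
      then show ?thesis using R by blast
    next
      case 2
      then have "A \<times> B \<subseteq> L \<or> A \<times> B \<inter> L = {}" using hom t AB by blast
      then show ?thesis using 2(2) S unfolding homogeneous_def by blast
    qed
  qed (use n part P1 Pn chain' in auto)
  have "merge_width r (G, L) \<le> (d + 1) ^ r + 2" for r
  proof -
    have bound: "card {A \<in> P (t - 1). \<exists>u\<in>A. reachable_within (R t) r v u} \<le> (d + 1) ^ r + 2"
      if t: "t \<in> {2..n}" for t v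
    proof -
      let ?S = "\<lambda>s. {A \<in> P s. \<exists>u\<in>A. reachable_within (R t) r v u}"
      have t1: "t \<in> {1..n}" using t by auto
      have "t - 1 \<in> {1..<n}" "Suc (t - 1) = t" using t by auto
      then have "merges (P (t - 1)) (P t)" using step[of "t - 1"] by simp
      then obtain A B where "P t = insert (A \<union> B) (P (t - 1) - {A, B})"
        unfolding merges_def by blast
      then have "?S (t - 1) \<subseteq> ?S t \<union> {A, B}" by auto
      moreover have "finite (?S t)" using finite_elements[OF fin part[OF t1]] by simp
      ultimately have "card (?S (t - 1)) \<le> card (?S t \<union> {A, B})" by (intro card_mono) auto
      also have "\<dots> \<le> card (?S t) + card {A, B}" by (rule card_Un_le)
      also have "\<dots> \<le> (twin_width G + 1) ^ r + 2"
        using card_parts_reachable[OF G part[OF t1] deg[OF t1], of r v] unfolding R_def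
        by (intro add_mono) (auto simp: card_insert_if)
      also have "\<dots> \<le> (d + 1) ^ r + 2" using tw by (simp add: power_mono)
      finally show ?thesis .
    qed
    have "merge_width r (G, L) \<le> radius_width r (G, L) n P R"
      unfolding merge_width_def by (rule Least_le) (use ms in blast)
    also have "\<dots> \<le> (d + 1) ^ r + 2"
      unfolding radius_width_def
      by (rule Max.boundedI[OF finite_radius_counts]) (use fin bound in auto)
    finally show ?thesis .
  qed
  then show ?thesis using og by blast
qed

section \<open>Bounded twin-width and bounded merge-width with an order\<close>

theorem corollary1p10:
  fixes C :: "'a pair_pre_digraph set"
  assumes "\<forall>G\<in>C. pair_graph G"
  shows "bounded_twin_width C \<longleftrightarrow>
    (\<exists>D :: 'a ordered_graph set.
       (\<forall>H\<in>D. ordered_graph H) \<and> bounded_merge_width D \<and> C = {G. \<exists>L. (G, L) \<in> D})"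
proof
  assume "bounded_twin_width C"
  then obtain d where d: "\<forall>G\<in>C. twin_width G \<le> d" unfolding bounded_twin_width_def by blast
  let ?D = "{(G, L). G \<in> C \<and> ordered_graph (G, L) \<and>
    (\<forall>r. merge_width r (G, L) \<le> (d + 1) ^ r + 2)}"
  have "bounded_merge_width ?D" unfolding bounded_merge_width_def by blast
  moreover have "C = {G. \<exists>L. (G, L) \<in> ?D}"
    using order_of_bounded_merge_width assms d by blast
  ultimately show "\<exists>D :: 'a ordered_graph set.
      (\<forall>H\<in>D. ordered_graph H) \<and> bounded_merge_width D \<and> C = {G. \<exists>L. (G, L) \<in> D}"
    by (intro exI[of _ ?D]) auto
next
  assume "\<exists>D :: 'a ordered_graph set.
      (\<forall>H\<in>D. ordered_graph H) \<and> bounded_merge_width D \<and> C = {G. \<exists>L. (G, L) \<in> D}"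
  then obtain D :: "'a ordered_graph set" where D: "\<forall>H\<in>D. ordered_graph H"
    "bounded_merge_width D" "C = {G. \<exists>L. (G, L) \<in> D}" by blast
  obtain k where k: "\<forall>H\<in>D. merge_width 2 H \<le> k"
    using D(2) unfolding bounded_merge_width_def by blast
  have "twin_width G \<le> k" if GC: "G \<in> C" for G
  proof -
    obtain L where GL: "(G, L) \<in> D" using D(3) GC by blast
    obtain m P R where "merge_sequence (G, L) m P R"
      "radius_width 2 (G, L) m P R = merge_width 2 (G, L)"
      using merge_width_attained D(1) GL by blast
    then show ?thesis using twin_width_le_radius_2_width[of "(G, L)"] D(1) GL k by fastforce
  qed
  then show "bounded_twin_width C" unfolding bounded_twin_width_def by blast
qed

end
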